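(* Let $F$ be a recursively enumerable formal system in which infinitely many different theorems can be proved, and let $\mathcal{G}_F$ be as in the context. If $F$ is inconsistent, then $\operatorname{VCdim}(\mathcal{G}_F)=\infty$.
   Context: Let $\mathbb{N}=\{0,1,2,\dots\}$. A formal system $F$ is consistent if no well-formed statement is provable together with its negation, and inconsistent otherwise. Fix a Gödel numbering in which translating statements and forming negations is primitive recursive; theorems are different iff they have different Gödel numbers. $F$ is recursively enumerable if there is a primitive recursive $\varphi:\mathbb{N}\to\mathbb{N}$ whose range is exactly the set of Gödel numbers of statements provable in $F$; fix such $\varphi$. Let $E^2:\mathbb{N}\to\mathbb{N}\times\mathbb{N}$ be a bijection with primitive recursive components $E^2_1,E^2_2$ and primitive recursive inverse. Let $c_c(\{0,1\})$ be the set of finitely supported $a:\mathbb{N}\to\{0,1\}$. For such $a$ let $g_a(n)=a(n)$ if the statement with Gödel number $\varphi(E^2_1(n))$ is the negation of the statement with Gödel number $\varphi(E^2_2(n))$, and $g_a(n)=0$ otherwise; $\mathcal{G}_F=\{g_a: a\in c_c(\{0,1\})\}$. $\operatorname{VCdim}(\mathcal{G})=\sup\{n: \exists S, |S|=n, |\mathcal{G}|_S|=2^n\}$.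
   Formalization: The formal system is additionally assumed to satisfy ex falso quodlibet (a statement and its negation derive every well-formed statement); otherwise a system proving p_0, p_1, ... and not-p_0, listed without repetition, is inconsistent but has VC dimension 1. *)

theory Defs
  imports "HOL-Library.Nat_Bijection" "HOL-Library.Extended_Nat" "HOL-Library.FuncSet"
begin

section \<open>Primitive recursive functions\<close>

text \<open>\<open>prim_recursive n f\<close>: the \<open>n\<close>-ary function \<open>f\<close> is primitive recursive. Arguments are passed
  as a list; the values of \<open>f\<close> on lists whose length is not \<open>n\<close> carry no meaning. Constants of
  positive arity come from \<open>zero\<close> by composition with \<open>fs = []\<close>.\<close>

inductive prim_recursive :: "nat \<Rightarrow> (nat list \<Rightarrow> nat) \<Rightarrow> bool" where
  zero: "prim_recursive 0 (\<lambda>_. 0)"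
| succ: "prim_recursive 1 (\<lambda>xs. Suc (xs ! 0))"
| proj: "i < n \<Longrightarrow> prim_recursive n (\<lambda>xs. xs ! i)"
| comp: "prim_recursive (length fs) g \<Longrightarrow> (\<forall>f\<in>set fs. prim_recursive n f)
    \<Longrightarrow> prim_recursive n (\<lambda>xs. g (map (\<lambda>f. f xs) fs))"
| prec: "prim_recursive n g \<Longrightarrow> prim_recursive (n + 2) h
    \<Longrightarrow> prim_recursive (n + 1)
          (\<lambda>xs. rec_nat (g (tl xs)) (\<lambda>k r. h (k # r # tl xs)) (hd xs))"

definition prim_recursive1 :: "(nat \<Rightarrow> nat) \<Rightarrow> bool" where
  "prim_recursive1 f \<longleftrightarrow> (\<exists>p. prim_recursive 1 p \<and> (\<forall>x. f x = p [x]))"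

definition prim_recursive2 :: "(nat \<Rightarrow> nat \<Rightarrow> nat) \<Rightarrow> bool" where
  "prim_recursive2 f \<longleftrightarrow> (\<exists>p. prim_recursive 2 p \<and> (\<forall>x y. f x y = p [x, y]))"

definition prim_recursive_pairing :: "(nat \<Rightarrow> nat \<times> nat) \<Rightarrow> bool" where
  "prim_recursive_pairing E \<longleftrightarrow> bij E
     \<and> prim_recursive1 (\<lambda>n. fst (E n)) \<and> prim_recursive1 (\<lambda>n. snd (E n))
     \<and> prim_recursive2 (\<lambda>x y. inv E (x, y))"

section \<open>Formal systems\<close>

text \<open>Statements are words over a countable alphabet, whose symbols are identified with natural
  numbers. An inference rule instance is a list of premises together with a conclusion.\<close>

type_synonym statement = "nat list"

record formal_system =
  wff :: "statement set"
  neg :: "statement \<Rightarrow> statement"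
  axms :: "statement set"
  rules :: "(statement list \<times> statement) set"

inductive_set consequences :: "formal_system \<Rightarrow> statement set \<Rightarrow> statement set"
  for F :: formal_system and \<Gamma> :: "statement set" where
  axm: "s \<in> axms F \<Longrightarrow> s \<in> consequences F \<Gamma>"
| hyp: "s \<in> \<Gamma> \<Longrightarrow> s \<in> consequences F \<Gamma>"
| rule: "(ps, s) \<in> rules F \<Longrightarrow> (\<forall>p\<in>set ps. p \<in> consequences F \<Gamma>) \<Longrightarrow> s \<in> consequences F \<Gamma>"

definition theorems_of :: "formal_system \<Rightarrow> statement set" where
  "theorems_of F = consequences F {}"

text \<open>The last conjunct says that the underlying logic validates ex falso quodlibet, as classical
  and intuitionistic logic do. This is all of the logic that is required. It does not restrict
  \<open>F\<close> to be consistent or inconsistent. It cannot be dropped: a paraconsistent calculus may prove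
  infinitely many theorems but only one statement together with its negation.\<close>

definition is_formal_system :: "formal_system \<Rightarrow> bool" where
  "is_formal_system F \<longleftrightarrow>
     (\<forall>s\<in>wff F. neg F s \<in> wff F)
     \<and> axms F \<subseteq> wff F
     \<and> (\<forall>(ps, s)\<in>rules F. set ps \<subseteq> wff F \<and> s \<in> wff F)
     \<and> (\<forall>s\<in>wff F. \<forall>t\<in>wff F. t \<in> consequences F {s, neg F s})"

definition consistent :: "formal_system \<Rightarrow> bool" where
  "consistent F \<longleftrightarrow> \<not> (\<exists>s\<in>wff F. s \<in> theorems_of F \<and> neg F s \<in> theorems_of F)"

text \<open>Primitive recursiveness of the translation of statements into Goedel numbers is understood
  relative to the standard encoding \<^const>\<open>list_encode\<close> of words.\<close>

definition goedel_numbering :: "formal_system \<Rightarrow> (statement \<Rightarrow> nat) \<Rightarrow> bool" where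
  "goedel_numbering F gn \<longleftrightarrow>
     inj_on gn (wff F)
     \<and> (\<exists>\<tau>. prim_recursive1 \<tau> \<and> (\<forall>s\<in>wff F. gn s = \<tau> (list_encode s)))
     \<and> (\<exists>\<nu>. prim_recursive1 \<nu> \<and> (\<forall>s\<in>wff F. gn (neg F s) = \<nu> (gn s)))"

text \<open>\<open>F\<close> is recursively enumerable iff some \<open>\<phi>\<close> enumerates its theorems in the following sense.\<close>

definition enumerates_theorems ::
    "formal_system \<Rightarrow> (statement \<Rightarrow> nat) \<Rightarrow> (nat \<Rightarrow> nat) \<Rightarrow> bool" where
  "enumerates_theorems F gn \<phi> \<longleftrightarrow> prim_recursive1 \<phi> \<and> range \<phi> = gn ` theorems_of F"

definition recursively_enumerable :: "formal_system \<Rightarrow> (statement \<Rightarrow> nat) \<Rightarrow> bool" where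
  "recursively_enumerable F gn \<longleftrightarrow> (\<exists>\<phi>. enumerates_theorems F gn \<phi>)"

section \<open>The function class and its VC dimension\<close>

definition c\<^sub>c :: "(nat \<Rightarrow> nat) set" where
  "c\<^sub>c = {a. range a \<subseteq> {0, 1} \<and> finite {n. a n \<noteq> 0}}"

definition g_fun :: "formal_system \<Rightarrow> (statement \<Rightarrow> nat) \<Rightarrow> (nat \<Rightarrow> nat) \<Rightarrow> (nat \<Rightarrow> nat \<times> nat)
    \<Rightarrow> (nat \<Rightarrow> nat) \<Rightarrow> nat \<Rightarrow> nat" where
  "g_fun F gn \<phi> E a n =
     (if \<exists>s\<in>wff F. \<exists>t\<in>wff F. gn s = \<phi> (fst (E n)) \<and> gn t = \<phi> (snd (E n)) \<and> s = neg F t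
      then a n else 0)"

definition G_class :: "formal_system \<Rightarrow> (statement \<Rightarrow> nat) \<Rightarrow> (nat \<Rightarrow> nat) \<Rightarrow> (nat \<Rightarrow> nat \<times> nat)
    \<Rightarrow> (nat \<Rightarrow> nat) set" where
  "G_class F gn \<phi> E = g_fun F gn \<phi> E ` c\<^sub>c"

definition VCdim :: "('x \<Rightarrow> nat) set \<Rightarrow> enat" where
  "VCdim G = Sup {enat n |n. \<exists>S. finite S \<and> card S = n \<and> card ((\<lambda>g. restrict g S) ` G) = 2 ^ n}"

end

theory Submission
  imports Defs
begin

text \<open>By ex falso quodlibet, an inconsistent system proves every well-formed statement. Hence each
  of the infinitely many statements \<open>t\<close> is listed by \<open>\<phi>\<close> together with its negation, and the
  corresponding index pairs yield infinitely many \<open>n\<close> at which \<open>g\<^sub>a n = a n\<close>. On such points the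
  class consists of all \<open>{0, 1}\<close>-valued functions, so each finite set of them is shattered.\<close>

lemma theorems_of_subset_wff:
  assumes "is_formal_system F"
  shows "theorems_of F \<subseteq> wff F"
proof
  fix s assume "s \<in> theorems_of F"
  then have "s \<in> consequences F {}"
    by (simp add: theorems_of_def)
  then show "s \<in> wff F"
    by induction (use assms in \<open>auto simp: is_formal_system_def\<close>)
qed

text \<open>Cut: in a derivation from \<open>\<Gamma>\<close>, each use of a hypothesis is replaced
  by its derivation from \<open>\<Delta>\<close>. With \<open>\<Delta> = {}\<close> this discharges
  the contradictory pair from which ex falso derives everything.\<close>

lemma consequences_cut:
  assumes "s \<in> consequences F \<Gamma>" "\<Gamma> \<subseteq> consequences F \<Delta>"
  shows "s \<in> consequences F \<Delta>"
  using assms by induction (auto intro: consequences.intros)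

lemma theorems_of_inconsistent:
  assumes "is_formal_system F" "\<not> consistent F"
  shows "theorems_of F = wff F"
proof
  show "theorems_of F \<subseteq> wff F"
    using assms(1) by (rule theorems_of_subset_wff)
  obtain s where s: "s \<in> wff F" "{s, neg F s} \<subseteq> consequences F {}"
    using assms(2) by (auto simp: consistent_def theorems_of_def)
  have "t \<in> consequences F {s, neg F s}" if "t \<in> wff F" for t
    using assms(1) s(1) that by (simp add: is_formal_system_def)
  then show "wff F \<subseteq> theorems_of F"
    using consequences_cut[OF _ s(2)] by (auto simp: theorems_of_def)
qed

text \<open>These are the coordinates at which \<open>g_fun\<close> lets \<open>a\<close> through
  unmasked.\<close>

definition negation_pairs ::
    "formal_system \<Rightarrow> (statement \<Rightarrow> nat) \<Rightarrow> (nat \<Rightarrow> nat) \<Rightarrow> (nat \<Rightarrow> nat \<times> nat) \<Rightarrow> nat set" where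
  "negation_pairs F gn \<phi> E =
     {n. \<exists>s\<in>wff F. \<exists>t\<in>wff F. gn s = \<phi> (fst (E n)) \<and> gn t = \<phi> (snd (E n)) \<and> s = neg F t}"

lemma g_fun_negation_pairs:
  "n \<in> negation_pairs F gn \<phi> E \<Longrightarrow> g_fun F gn \<phi> E a n = a n"
  by (auto simp: negation_pairs_def g_fun_def)

text \<open>The second component alone suffices: \<open>\<phi> (snd (E n))\<close> already takes
  every code of a well-formed statement as \<open>n\<close> runs over the set, and injectivity of
  \<open>gn\<close> makes these codes infinite in number.\<close>

lemma infinite_negation_pairs:
  assumes closed: "\<And>t. t \<in> wff F \<Longrightarrow> neg F t \<in> wff F"
    and inj: "inj_on gn (wff F)"
    and range: "gn ` wff F \<subseteq> range \<phi>"
    and "surj E"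
    and inf: "infinite (wff F)"
  shows "infinite (negation_pairs F gn \<phi> E)"
proof
  assume fin: "finite (negation_pairs F gn \<phi> E)"
  have "gn ` wff F \<subseteq> (\<lambda>n. \<phi> (snd (E n))) ` negation_pairs F gn \<phi> E"
  proof
    fix x assume "x \<in> gn ` wff F"
    then obtain t where t: "t \<in> wff F" "x = gn t" by blast
    obtain i j where ij: "gn (neg F t) = \<phi> i" "gn t = \<phi> j"
      using range t(1) closed[OF t(1)] by blast
    obtain n where n: "E n = (i, j)"
      using \<open>surj E\<close> by (metis surjD)
    have "n \<in> negation_pairs F gn \<phi> E"
      using t(1) closed ij n by (auto simp: negation_pairs_def)
    then show "x \<in> (\<lambda>n. \<phi> (snd (E n))) ` negation_pairs F gn \<phi> E"
      using t(2) ij(2) n by force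
  qed
  then have "finite (gn ` wff F)"
    using fin finite_surj by blast
  then show False
    using inf inj finite_imageD by blast
qed

lemma restrict_G_class:
  assumes "finite S" "S \<subseteq> negation_pairs F gn \<phi> E"
  shows "(\<lambda>g. restrict g S) ` G_class F gn \<phi> E = S \<rightarrow>\<^sub>E {0, 1}"
proof
  have "restrict (g_fun F gn \<phi> E a) S \<in> S \<rightarrow>\<^sub>E {0, 1}" if "a \<in> c\<^sub>c" for a
    using that by (auto simp: c\<^sub>c_def g_fun_def image_subset_iff)
  then show "(\<lambda>g. restrict g S) ` G_class F gn \<phi> E \<subseteq> S \<rightarrow>\<^sub>E {0, 1}"
    by (simp only: G_class_def image_image image_subset_iff) simp
next
  show "S \<rightarrow>\<^sub>E {0, 1} \<subseteq> (\<lambda>g. restrict g S) ` G_class F gn \<phi> E"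
  proof
    fix h :: "nat \<Rightarrow> nat" assume h: "h \<in> S \<rightarrow>\<^sub>E {0, 1}"
    \<comment> \<open>Extending by 0 keeps the support inside the finite set \<open>S\<close>, so
      the pattern \<open>h\<close> is realised within \<open>c\<^sub>c\<close>.\<close>
    define a where "a n = (if n \<in> S then h n else 0)" for n
    have "{n. a n \<noteq> 0} \<subseteq> S"
      by (auto simp: a_def)
    then have "finite {n. a n \<noteq> 0}"
      using assms(1) finite_subset by blast
    moreover have "range a \<subseteq> {0, 1}"
      using PiE_mem[OF h] by (simp add: a_def image_subset_iff)
    ultimately have "a \<in> c\<^sub>c"
      by (simp add: c\<^sub>c_def)
    moreover have "h = restrict (g_fun F gn \<phi> E a) S"
    proof
      \<comment> \<open>Off \<open>S\<close> both sides are \<open>undefined\<close>, as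
        \<open>h\<close> is extensional.\<close>
      fix n show "h n = restrict (g_fun F gn \<phi> E a) S n"
        using h assms(2) by (cases "n \<in> S") (auto simp: g_fun_negation_pairs a_def)
    qed
    ultimately show "h \<in> (\<lambda>g. restrict g S) ` G_class F gn \<phi> E"
      by (auto simp: G_class_def)
  qed
qed

lemma VCdim_eq_infinity:
  assumes "\<And>n. \<exists>S. finite S \<and> card S = n \<and> card ((\<lambda>g. restrict g S) ` G) = 2 ^ n"
  shows "VCdim G = \<infinity>"
proof -
  have "enat n \<le> VCdim G" for n
    unfolding VCdim_def using assms by (intro Sup_upper) blast
  \<comment> \<open>A finite value \<open>enat k\<close> would be refuted by the bound at
    \<open>Suc k\<close>.\<close>
  then show ?thesis
    by (metis enat_ord_simps(1) not_infinity_eq Suc_n_not_le_n)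
qed

theorem theorem2p7:
  fixes F :: formal_system
    and gn :: "statement \<Rightarrow> nat"
    and \<phi> :: "nat \<Rightarrow> nat"
    and E :: "nat \<Rightarrow> nat \<times> nat"
  assumes "is_formal_system F"
    and "goedel_numbering F gn"
    and "recursively_enumerable F gn"
    and "enumerates_theorems F gn \<phi>"
    and "prim_recursive_pairing E"
    and "infinite (theorems_of F)"
    and "\<not> consistent F"
  shows "VCdim (G_class F gn \<phi> E) = \<infinity>"
proof (rule VCdim_eq_infinity)
  fix n
  have thms: "theorems_of F = wff F"
    using assms(1,7) by (rule theorems_of_inconsistent)
  have "infinite (negation_pairs F gn \<phi> E)"
  proof (rule infinite_negation_pairs)
    show "neg F t \<in> wff F" if "t \<in> wff F" for t
      using assms(1) that by (simp add: is_formal_system_def)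
    show "inj_on gn (wff F)"
      using assms(2) by (simp add: goedel_numbering_def)
    show "gn ` wff F \<subseteq> range \<phi>"
      using assms(4) thms by (simp add: enumerates_theorems_def)
    show "surj E"
      using assms(5) by (simp add: prim_recursive_pairing_def bij_is_surj)
    show "infinite (wff F)"
      using assms(6) thms by simp
  qed
  then obtain S where S: "finite S" "card S = n" "S \<subseteq> negation_pairs F gn \<phi> E"
    using infinite_arbitrarily_large by blast
  \<comment> \<open>The traces on \<open>S\<close> form the full function space into
    \<open>{0, 1}\<close>, with two choices at each of the \<open>n\<close> points.\<close>
  then have "card ((\<lambda>g. restrict g S) ` G_class F gn \<phi> E) = 2 ^ n"
    by (simp add: restrict_G_class card_PiE numeral_2_eq_2)
  with S show "\<exists>S. finite S \<and> card S = n
      \<and> card ((\<lambda>g. restrict g S) ` G_class F gn \<phi> E) = 2 ^ n"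
    by blast
qed

end
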